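(* Let $K$ be a field of characteristic $0$, let $n\ge 2$, and let $R$ be a proper retract of $K[x_1,\dots,x_n]$ generated (as a $K$-algebra) by polynomials $p_1,\dots,p_n$. Then $p_1,\dots,p_n$ are algebraically dependent over $K$.
   Context: A $K$-subalgebra $R$ of $A=K[x_1,\dots,x_n]$ is called a retract if there is an idempotent $K$-algebra endomorphism $\varphi$ of $A$ with $\varphi(A)=R$; it is proper if it is different from $K$ and from $A$. *)

theory Defs
  imports Complex_Main "HOL-Library.Cardinality" "HOL-Library.Poly_Mapping"
begin

text \<open>
  A monomial is the finitely supported map from variables to exponents, so for a finite index
  type \<open>'v\<close> this is \<open>K[x\<^sub>1, \<dots>, x\<^sub>n]\<close> with \<open>n = CARD('v)\<close>; the ring operations (convolution
  product) are those of \<^theory>\<open>HOL-Library.Poly_Mapping\<close>.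
\<close>

type_synonym ('v, 'k) mpoly = "('v \<Rightarrow>\<^sub>0 nat) \<Rightarrow>\<^sub>0 'k"

definition Const :: "'k \<Rightarrow> ('v, 'k::zero) mpoly" where
  "Const c = Poly_Mapping.single 0 c"

definition poly_subst :: "('v \<Rightarrow> ('w, 'k) mpoly) \<Rightarrow> ('v, 'k::comm_ring_1) mpoly \<Rightarrow> ('w, 'k) mpoly" where
  "poly_subst p f = (\<Sum>m\<in>Poly_Mapping.keys f. Const (Poly_Mapping.lookup f m) *
      (\<Prod>i\<in>Poly_Mapping.keys m. p i ^ Poly_Mapping.lookup m i))"

text \<open>Closure under negation follows from \<open>Const (-1)\<close> lying in the set.\<close>

definition subalgebra :: "('v, 'k::comm_ring_1) mpoly set \<Rightarrow> bool" where
  "subalgebra R \<longleftrightarrow> (\<forall>c. Const c \<in> R) \<and> (\<forall>f\<in>R. \<forall>g\<in>R. f + g \<in> R \<and> f * g \<in> R)"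

definition alg_hom :: "(('v, 'k::comm_ring_1) mpoly \<Rightarrow> ('w, 'k) mpoly) \<Rightarrow> bool" where
  "alg_hom \<phi> \<longleftrightarrow> (\<forall>c. \<phi> (Const c) = Const c) \<and>
     (\<forall>f g. \<phi> (f + g) = \<phi> f + \<phi> g) \<and> (\<forall>f g. \<phi> (f * g) = \<phi> f * \<phi> g)"

definition retract :: "('v, 'k::comm_ring_1) mpoly set \<Rightarrow> bool" where
  "retract R \<longleftrightarrow> subalgebra R \<and> (\<exists>\<phi>. alg_hom \<phi> \<and> \<phi> \<circ> \<phi> = \<phi> \<and> range \<phi> = R)"

definition proper_retract :: "('v, 'k::comm_ring_1) mpoly set \<Rightarrow> bool" where
  "proper_retract R \<longleftrightarrow> retract R \<and> R \<noteq> range Const \<and> R \<noteq> UNIV"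

text \<open>
  Dependence is a property of the indexed family: a family with a repeated entry is dependent.
\<close>

definition algebraically_dependent :: "('v \<Rightarrow> ('w, 'k::comm_ring_1) mpoly) \<Rightarrow> bool" where
  "algebraically_dependent p \<longleftrightarrow> (\<exists>f. f \<noteq> 0 \<and> poly_subst p f = 0)"

end

theory Submission
  imports Defs "HOL-Analysis.Determinants"
begin

text \<open>
  Let \<open>\<phi>\<close> be an idempotent endomorphism with image \<open>R = K[p\<^sub>1, \<dots>, p\<^sub>n]\<close>. As \<open>R\<close> is not the whole
  polynomial ring, \<open>\<phi>\<close> moves some variable \<open>x\<^sub>i\<close>, and \<open>h = x\<^sub>i - \<phi>(x\<^sub>i)\<close> is then a nonzero element of
  its kernel. Since \<open>\<phi>(x\<^sub>j)\<close> lies in \<open>R\<close>, it can be written as \<open>Q\<^sub>j(p)\<close>. Suppose that the \<open>p\<^sub>k\<close> are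
  algebraically independent, so that identities between polynomials in \<open>p\<close> hold already between
  polynomials in the variables. Then \<open>\<phi>(h) = h(Q(p)) = 0\<close> gives \<open>h(Q) = 0\<close>, and
  \<open>\<phi>(p\<^sub>k) = p\<^sub>k(Q(p)) = p\<^sub>k\<close> gives \<open>p\<^sub>k(Q) = x\<^sub>k\<close>. So substituting \<open>Q\<close> is an endomorphism that is
  surjective but not injective.

  In characteristic \<open>0\<close> differential calculus excludes this (lemma
  \<open>poly_subst_injective_if_left_inverse\<close>). By the chain rule, the identities \<open>p\<^sub>k(Q) = x\<^sub>k\<close> say that
  the Jacobian matrix of \<open>Q\<close> has a left inverse; being square, it annihilates no nonzero row vector
  (lemma \<open>vector_matrix_mult_eq_0_imp\<close>). If \<open>g(Q) = 0\<close>, the chain rule says that the row vector of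
  the \<open>(\<partial>\<^sub>i g)(Q)\<close> is annihilated by this matrix, so \<open>(\<partial>\<^sub>i g)(Q) = 0\<close> for every \<open>i\<close>. By induction on
  the degree all \<open>\<partial>\<^sub>i g\<close> vanish, hence \<open>g\<close> is a constant, and \<open>g = g(Q) = 0\<close>.
\<close>

section \<open>Polynomials and substitution\<close>

abbreviation (input) lookup where "lookup \<equiv> Poly_Mapping.lookup"
abbreviation (input) single where "single \<equiv> Poly_Mapping.single"
abbreviation (input) keys where "keys \<equiv> Poly_Mapping.keys"

definition Var :: "'v \<Rightarrow> ('v, 'k::comm_ring_1) mpoly" where
  "Var i = single (single i 1) 1"

lemma Const_0 [simp]: "Const 0 = 0"
  by (simp add: Const_def)

lemma Const_1 [simp]: "Const 1 = 1"
  by (simp add: Const_def)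

lemma Const_add: "Const (a + b) = Const a + Const b"
  by (simp add: Const_def single_add)

lemma Const_mult: "Const (a * b) = Const a * (Const b :: ('v, 'k::comm_ring_1) mpoly)"
  by (simp add: Const_def mult_single)

lemma poly_mapping_sum_single: "f = (\<Sum>m\<in>keys f. single m (lookup f m))"
  by (rule poly_mapping_eqI)
    (simp add: lookup_sum lookup_single when_def not_in_keys_iff_lookup_eq_zero)

lemma poly_mapping_single_induct [case_names single add]:
  fixes f :: "'a \<Rightarrow>\<^sub>0 'b::comm_monoid_add"
  assumes single: "\<And>m c. P (single m c)" and add: "\<And>f g. P f \<Longrightarrow> P g \<Longrightarrow> P (f + g)"
  shows "P f"
proof -
  have "P (\<Sum>m\<in>A. single m (lookup f m))" if "finite A" for A
    using that
  proof (induction A rule: finite_induct)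
    case empty
    show ?case using single[of _ 0] by simp
  next
    case (insert m A)
    then show ?case using add single by simp
  qed
  then show ?thesis
    by (metis poly_mapping_sum_single finite_keys)
qed

lemma Var_power: "Var i ^ n = (single (single i n) 1 :: ('v, 'k::comm_ring_1) mpoly)"
  by (induction n) (simp_all add: Var_def mult_single flip: single_add)

lemma prod_single_1:
  "(\<Prod>i\<in>A. single (m i) 1) = (single (\<Sum>i\<in>A. m i) 1 :: ('v, 'k::comm_ring_1) mpoly)"
  by (induction A rule: infinite_finite_induct) (simp_all add: mult_single)

lemma single_eq_monomial:
  "single m c = Const c * (\<Prod>i\<in>keys m. (Var i :: ('v, 'k::comm_ring_1) mpoly) ^ lookup m i)"
  unfolding Var_power prod_single_1 poly_mapping_sum_single[of m, symmetric]
  by (simp add: Const_def mult_single)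

lemma mpoly_induct [case_names Const Var add mult]:
  fixes f :: "('v, 'k::comm_ring_1) mpoly"
  assumes Const: "\<And>c. P (Const c)" and Var: "\<And>i. P (Var i)"
    and add: "\<And>f g. P f \<Longrightarrow> P g \<Longrightarrow> P (f + g)" and mult: "\<And>f g. P f \<Longrightarrow> P g \<Longrightarrow> P (f * g)"
  shows "P f"
proof (induction f rule: poly_mapping_single_induct)
  case (single m c)
  have 1: "P 1" using Const[of 1] by simp
  have "P (Var i ^ n)" for i n
    by (induction n) (simp_all add: 1 Var mult)
  then have "P (\<Prod>i\<in>A. Var i ^ lookup m i)" for A
    by (induction A rule: infinite_finite_induct) (simp_all add: 1 mult)
  then show ?case
    unfolding single_eq_monomial by (intro mult Const)
qed (rule add)

lemma alg_hom_Const: "alg_hom \<phi> \<Longrightarrow> \<phi> (Const c) = Const c"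
  and alg_hom_add: "alg_hom \<phi> \<Longrightarrow> \<phi> (f + g) = \<phi> f + \<phi> g"
  and alg_hom_mult: "alg_hom \<phi> \<Longrightarrow> \<phi> (f * g) = \<phi> f * \<phi> g"
  by (simp_all add: alg_hom_def)

lemma alg_hom_diff:
  assumes "alg_hom \<phi>" shows "\<phi> (f - g) = \<phi> f - \<phi> g"
  using alg_hom_add[OF assms, of "f - g" g] by (simp add: algebra_simps)

lemma alg_hom_0: "alg_hom \<phi> \<Longrightarrow> \<phi> 0 = 0"
  using alg_hom_Const[of \<phi> 0] by simp

lemma alg_hom_1: "alg_hom \<phi> \<Longrightarrow> \<phi> 1 = 1"
  using alg_hom_Const[of \<phi> 1] by simp

lemma alg_hom_comp: "alg_hom \<phi> \<Longrightarrow> alg_hom \<psi> \<Longrightarrow> alg_hom (\<lambda>f. \<phi> (\<psi> f))"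
  by (simp add: alg_hom_def)

lemma alg_hom_eqI:
  assumes "alg_hom \<phi>" "alg_hom \<psi>" "\<And>i. \<phi> (Var i) = \<psi> (Var i)"
  shows "\<phi> f = \<psi> f"
  by (induction f rule: mpoly_induct)
    (use assms in \<open>simp_all add: alg_hom_Const alg_hom_add alg_hom_mult\<close>)

lemma poly_subst_superset:
  assumes "finite A" "keys f \<subseteq> A"
  shows "poly_subst p f =
    (\<Sum>m\<in>A. Const (lookup f m) * (\<Prod>i\<in>keys m. p i ^ lookup m i))"
  unfolding poly_subst_def using assms
  by (intro sum.mono_neutral_left) (auto simp: not_in_keys_iff_lookup_eq_zero)

lemma poly_subst_single:
  fixes p :: "'v::finite \<Rightarrow> ('w, 'k::comm_ring_1) mpoly"
  shows "poly_subst p (single m c) = Const c * (\<Prod>i\<in>UNIV. p i ^ lookup m i)"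
proof -
  have "(\<Prod>i\<in>keys m. p i ^ lookup m i) = (\<Prod>i\<in>UNIV. p i ^ lookup m i)"
    by (rule prod.mono_neutral_left) (auto simp: not_in_keys_iff_lookup_eq_zero)
  then show ?thesis
    by (subst poly_subst_superset[of "{m}"]) auto
qed

lemma poly_subst_add: "poly_subst p (f + g) = poly_subst p f + poly_subst p g"
proof -
  let ?A = "keys f \<union> keys g"
  have "keys (f + g) \<subseteq> ?A" by (rule Poly_Mapping.keys_add)
  then show ?thesis
    by (subst (1 2 3) poly_subst_superset[of ?A])
      (auto simp: lookup_add Const_add distrib_right sum.distrib)
qed

lemma poly_subst_mult:
  fixes p :: "'v::finite \<Rightarrow> ('w, 'k::comm_ring_1) mpoly"
  shows "poly_subst p (f * g) = poly_subst p f * poly_subst p g"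
proof (induction f rule: poly_mapping_single_induct)
  case (single m c)
  show ?case
  proof (induction g rule: poly_mapping_single_induct)
    case (single n d)
    show ?case
      by (simp add: mult_single poly_subst_single Const_mult lookup_add power_add
          prod.distrib ac_simps)
  qed (simp add: distrib_left poly_subst_add)
qed (simp add: distrib_right poly_subst_add)

lemma alg_hom_poly_subst: "alg_hom (poly_subst (p :: 'v::finite \<Rightarrow> ('w, 'k::comm_ring_1) mpoly))"
  unfolding alg_hom_def
  by (simp add: poly_subst_add poly_subst_mult) (simp add: Const_def poly_subst_single)

lemma poly_subst_Var [simp]: "poly_subst p (Var i) = p (i :: 'v::finite)"
proof -
  have "(\<Prod>j\<in>UNIV. p j ^ lookup (single i 1) j) = (\<Prod>j\<in>UNIV. if j = i then p j else 1)"
    by (rule prod.cong) (auto simp: lookup_single when_def)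
  then show ?thesis
    by (simp add: Var_def poly_subst_single)
qed

lemma poly_subst_Var_eq [simp]: "poly_subst Var f = (f :: ('v::finite, 'k::comm_ring_1) mpoly)"
  by (rule alg_hom_eqI[OF alg_hom_poly_subst]) (simp_all add: alg_hom_def)

lemma subalgebra_hull_subset_range_poly_subst:
  fixes p :: "'v::finite \<Rightarrow> ('w, 'k::comm_ring_1) mpoly"
  shows "subalgebra hull (range p) \<subseteq> range (poly_subst p)"
proof (rule hull_minimal)
  show "range p \<subseteq> range (poly_subst p)"
    by (metis image_subset_iff poly_subst_Var rangeI)
  have "Const c \<in> range (poly_subst p)" for c
    by (metis alg_hom_Const alg_hom_poly_subst rangeI)
  then show "subalgebra (range (poly_subst p))"
    unfolding subalgebra_def by (auto simp flip: poly_subst_add poly_subst_mult)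
qed

lemma inj_poly_substI:
  fixes p :: "'v::finite \<Rightarrow> ('w, 'k::comm_ring_1) mpoly"
  assumes "\<not> algebraically_dependent p"
  shows "inj (poly_subst p)"
proof (rule injI)
  fix f g
  assume "poly_subst p f = poly_subst p g"
  then have "poly_subst p (f - g) = 0"
    by (simp add: alg_hom_diff[OF alg_hom_poly_subst])
  then have "f - g = 0"
    using assms unfolding algebraically_dependent_def by blast
  then show "f = g" by simp
qed

section \<open>Partial derivatives\<close>

text \<open>
  The coefficient of \<open>x\<^sup>m\<close> in \<open>\<partial>\<^sub>i f\<close> is \<open>m\<^sub>i + 1\<close> times that of \<open>x\<^sub>i x\<^sup>m\<close> in \<open>f\<close>; in this
  coefficientwise form linearity is immediate.
\<close>

definition pderiv_at :: "'v \<Rightarrow> ('v, 'k::comm_ring_1) mpoly \<Rightarrow> ('v, 'k) mpoly" where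
  "pderiv_at i f =
    Abs_poly_mapping (\<lambda>m. of_nat (Suc (lookup m i)) * lookup f (m + single i 1))"

lemma lookup_pderiv_at:
  "lookup (pderiv_at i f) m = of_nat (Suc (lookup m i)) * lookup f (m + single i 1)"
proof -
  have "finite ((\<lambda>m. m + single i 1) -` keys f)"
    by (rule finite_vimageI) (auto intro: injI)
  then have "finite {m. of_nat (Suc (lookup m i)) * lookup f (m + single i 1) \<noteq> 0}"
    by (rule rev_finite_subset) (auto simp: in_keys_iff)
  then show ?thesis
    unfolding pderiv_at_def by simp
qed

lemma pderiv_at_0 [simp]: "pderiv_at i 0 = 0"
  by (rule poly_mapping_eqI) (simp add: lookup_pderiv_at)

lemma pderiv_at_add: "pderiv_at i (f + g) = pderiv_at i f + pderiv_at i g"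
  by (rule poly_mapping_eqI) (simp add: lookup_pderiv_at lookup_add distrib_left)

lemma minus_plus_single:
  assumes "lookup m i > 0"
  shows "m - single i 1 + single i (1 :: nat) = m"
  by (rule poly_mapping_eqI)
    (use assms in \<open>auto simp: lookup_add lookup_minus lookup_single when_def\<close>)

lemma minus_single_plus:
  assumes "lookup m i > 0"
  shows "m - single i (1 :: nat) + n = m + n - single i 1"
  by (rule poly_mapping_eqI)
    (use assms in \<open>auto simp: lookup_add lookup_minus lookup_single when_def\<close>)

lemma pderiv_at_single:
  "pderiv_at i (single m c) = single (m - single i 1) (of_nat (lookup m i) * c)"
proof (rule poly_mapping_eqI)
  fix k
  show "lookup (pderiv_at i (single m c)) k =
    lookup (single (m - single i 1) (of_nat (lookup m i) * c)) k"
  proof (cases "lookup m i > 0")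
    case True
    then have "m = k + single i 1 \<longleftrightarrow> m - single i 1 = k"
      by (metis minus_plus_single add_diff_cancel_right')
    moreover have "Suc (lookup k i) = lookup m i" if "m = k + single i 1"
      using that by (simp add: lookup_add)
    ultimately show ?thesis
      by (simp add: lookup_pderiv_at lookup_single when_def del: of_nat_Suc)
  next
    case False
    then have "m \<noteq> k + single i 1"
      by (auto simp: lookup_add)
    with False show ?thesis
      by (simp add: lookup_pderiv_at lookup_single)
  qed
qed

lemma pderiv_at_mult: "pderiv_at i (f * g) = pderiv_at i f * g + f * pderiv_at i g"
proof (induction f rule: poly_mapping_single_induct)
  case (single m a)
  show ?case
  proof (induction g rule: poly_mapping_single_induct)
    case (single n b)
    have "single (m - single i 1 + n) (of_nat (lookup m i) * a * b) =
      single (m + n - single i 1) (of_nat (lookup m i) * a * b)"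
      by (cases "lookup m i > 0") (simp_all add: minus_single_plus del: One_nat_def)
    moreover have "single (m + (n - single i 1)) (a * (of_nat (lookup n i) * b)) =
      single (m + n - single i 1) (a * (of_nat (lookup n i) * b))"
      by (cases "lookup n i > 0") (simp_all add: minus_single_plus add.commute[of m] del: One_nat_def)
    ultimately show ?case
      by (simp add: mult_single pderiv_at_single lookup_add distrib_right single_add mult.assoc
          mult.left_commute[of a])
  qed (simp add: distrib_left pderiv_at_add)
qed (simp add: distrib_right pderiv_at_add)

lemma pderiv_at_Const [simp]: "pderiv_at i (Const c) = 0"
  by (simp add: Const_def pderiv_at_single)

lemma pderiv_at_Var: "pderiv_at j (Var i) = (if i = j then 1 else 0)"
  by (simp add: Var_def pderiv_at_single lookup_single when_def)

text \<open>Both sides are derivations along \<open>poly_subst Q\<close>, so it suffices to compare them on variables.\<close>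

lemma pderiv_at_poly_subst:
  fixes Q :: "'v::finite \<Rightarrow> ('w, 'k::comm_ring_1) mpoly"
  shows "pderiv_at j (poly_subst Q f) =
    (\<Sum>i\<in>UNIV. poly_subst Q (pderiv_at i f) * pderiv_at j (Q i))"
proof (induction f rule: mpoly_induct)
  case (Const c)
  show ?case
    by (simp add: alg_hom_Const[OF alg_hom_poly_subst] alg_hom_0[OF alg_hom_poly_subst])
next
  case (Var k)
  have "poly_subst Q (pderiv_at i (Var k)) = (if i = k then 1 else 0)" for i
    by (simp add: pderiv_at_Var alg_hom_0[OF alg_hom_poly_subst]
        alg_hom_1[OF alg_hom_poly_subst])
  then show ?case
    by (simp add: if_distrib[of "\<lambda>x. x * _"] cong: if_cong)
next
  case (add f g)
  then show ?case
    by (simp add: poly_subst_add pderiv_at_add distrib_right sum.distrib)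
next
  case (mult f g)
  then show ?case
    by (simp add: poly_subst_add poly_subst_mult pderiv_at_mult distrib_left sum.distrib
        sum_distrib_left sum_distrib_right ac_simps)
qed

lemma Const_if_pderiv_at_eq_0:
  fixes f :: "('v, 'k::{idom, ring_char_0}) mpoly"
  assumes "\<And>i. pderiv_at i f = 0"
  shows "f = Const (lookup f 0)"
proof (rule poly_mapping_eqI)
  fix m
  show "lookup f m = lookup (Const (lookup f 0)) m"
  proof (cases "m = 0")
    case False
    then obtain i where "lookup m i > 0"
      by (metis poly_mapping_eqI lookup_zero gr0I)
    then have "lookup (pderiv_at i f) (m - single i 1) =
        of_nat (Suc (lookup (m - single i 1) i)) * lookup f m"
      by (simp only: lookup_pderiv_at minus_plus_single)
    then have "lookup f m = 0"
      using assms by (simp del: of_nat_Suc)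
    then show ?thesis
      using False by (simp add: Const_def lookup_single)
  qed (simp add: Const_def)
qed

section \<open>Endomorphisms with a section are injective\<close>

text \<open>
  Replace row \<open>k\<close> of \<open>C\<close> by the combination \<open>v C\<close> of its rows. Linearity of the determinant in this
  row gives one term per \<open>j\<close>; those with a repeated row vanish, which leaves \<open>v\<^sub>k det C\<close>. But this row is
  zero. The left inverse makes \<open>det C\<close> a unit, so \<open>v\<^sub>k = 0\<close> follows without division.
\<close>

lemma vector_matrix_mult_eq_0_imp:
  fixes B C :: "'a::comm_ring_1^'n^'n"
  assumes BC: "B ** C = mat 1" and vC: "v v* C = 0"
  shows "v = 0"
proof -
  have "v $ k = 0" for k
  proof -
    have row: "(\<Sum>j\<in>UNIV. v $ j *s row j C) = 0"
      using vC by (simp add: vec_eq_iff vector_matrix_mult_def row_def mult.commute)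
    have repeated: "det (\<chi> i. if i = k then row j C else row i C) = (if j = k then det C else 0)" for j
    proof (cases "j = k")
      case True
      then have "(\<chi> i. if i = k then row j C else row i C) = C"
        by (simp add: vec_eq_iff row_def)
      with True show ?thesis by simp
    next
      case False
      then have "det (\<chi> i. if i = k then row j C else row i C) = 0"
        by (intro det_identical_rows[OF False]) (simp add: row_def vec_eq_iff)
      with False show ?thesis by simp
    qed
    have "0 = det (\<chi> i. if i = k then (\<Sum>j\<in>UNIV. v $ j *s row j C) else row i C)"
      unfolding row by (simp add: det_row_0)
    also have "\<dots> = (\<Sum>j\<in>UNIV. v $ j * (if j = k then det C else 0))"
      by (subst det_linear_row_sum) (simp_all add: det_row_mul repeated)
    also have "\<dots> = v $ k * det C"
      by (simp add: if_distrib cong: if_cong)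
    finally have "v $ k * det C = 0" by simp
    moreover have "det C * det B = 1"
      using arg_cong[OF BC, of det] by (simp add: det_mul mult.commute)
    ultimately show "v $ k = 0"
      by (metis mult.assoc mult.right_neutral mult_zero_left)
  qed
  then show ?thesis by (simp add: vec_eq_iff)
qed

text \<open>
  By the chain rule, substituting \<open>Q\<close> annihilates all partial derivatives of \<open>g\<close> as soon as it
  annihilates \<open>g\<close>, so the degree can be lowered down to the constants. Characteristic \<open>0\<close> enters in
  the last step, where a polynomial with vanishing derivatives has to be a constant.
\<close>

lemma poly_subst_injective_if_left_inverse:
  fixes P Q :: "'n::finite \<Rightarrow> ('n, 'k::{idom, ring_char_0}) mpoly"
  assumes inverse: "\<And>k. poly_subst Q (P k) = Var k"
    and "poly_subst Q g = 0"
  shows "g = 0"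
proof -
  have "g = 0" if "\<forall>m\<in>keys g. (\<Sum>i\<in>UNIV. lookup m i) \<le> N" "poly_subst Q g = 0" for N g
    using that
  proof (induction N arbitrary: g rule: less_induct)
    case (less N)
    define B :: "('n, 'k) mpoly^'n^'n" where "B = (\<chi> k i. poly_subst Q (pderiv_at i (P k)))"
    define C :: "('n, 'k) mpoly^'n^'n" where "C = (\<chi> i j. pderiv_at j (Q i))"
    define v :: "('n, 'k) mpoly^'n" where "v = (\<chi> i. poly_subst Q (pderiv_at i g))"
    \<comment> \<open>By the chain rule, \<open>B C\<close> is the Jacobian matrix of \<open>P(Q)\<close> and \<open>v C\<close> the gradient of \<open>g(Q)\<close>.\<close>
    have "B ** C = mat 1"
      by (simp add: vec_eq_iff matrix_matrix_mult_def B_def C_def mat_def inverse pderiv_at_Var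
          eq_commute[of _ "_ :: 'n"] flip: pderiv_at_poly_subst)
    moreover have "v v* C = 0"
    proof -
      have "(v v* C) $ j = pderiv_at j (poly_subst Q g)" for j
        by (simp add: pderiv_at_poly_subst vector_matrix_mult_def v_def C_def mult.commute)
      then show ?thesis
        using less.prems(2) by (simp add: vec_eq_iff)
    qed
    ultimately have "v = 0" by (rule vector_matrix_mult_eq_0_imp)
    then have v: "poly_subst Q (pderiv_at i g) = 0" for i
      by (simp add: v_def vec_eq_iff)
    have "pderiv_at i g = 0" for i
    proof (rule ccontr)
      assume nz: "pderiv_at i g \<noteq> 0"
      have deg: "Suc (\<Sum>j\<in>UNIV. lookup m j) \<le> N" if "m \<in> keys (pderiv_at i g)" for m
      proof -
        have "m + single i 1 \<in> keys g"
          using that by (auto simp: in_keys_iff lookup_pderiv_at)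
        then have "(\<Sum>j\<in>UNIV. lookup (m + single i 1) j) \<le> N"
          using less.prems(1) by blast
        then show ?thesis
          by (simp add: lookup_add sum.distrib lookup_single when_def)
      qed
      from nz obtain m where "m \<in> keys (pderiv_at i g)"
        by (metis keys_eq_empty ex_in_conv)
      with deg have "N - 1 < N" by fastforce
      then have "pderiv_at i g = 0"
        by (rule less.IH) (use deg v in force)+
      with nz show False by contradiction
    qed
    then have g: "g = Const (lookup g 0)"
      by (rule Const_if_pderiv_at_eq_0)
    then have "poly_subst Q g = g"
      by (metis alg_hom_Const alg_hom_poly_subst)
    with less.prems(2) show ?case by simp
  qed
  moreover obtain N where "\<forall>m\<in>keys g. (\<Sum>i\<in>UNIV. lookup m i) \<le> N"
    using finite_nat_set_iff_bounded_le[of "(\<lambda>m. \<Sum>i\<in>UNIV. lookup m i) ` keys g"] by auto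
  ultimately show ?thesis
    using assms(2) by blast
qed

section \<open>Generators of a proper retract\<close>

theorem proposition2p2:
  fixes p :: "'n::finite \<Rightarrow> ('n, 'k::field_char_0) mpoly"
    and R :: "('n, 'k) mpoly set"
  assumes "CARD('n) \<ge> 2"
    and "proper_retract R"
    and "R = subalgebra hull (range p)"
  shows "algebraically_dependent p"
proof (rule ccontr)
  assume "\<not> algebraically_dependent p"
  then have inj: "inj (poly_subst p)"
    by (rule inj_poly_substI)
  obtain \<phi> where hom: "alg_hom \<phi>" and idem: "\<phi> \<circ> \<phi> = \<phi>" and R: "range \<phi> = R"
    and "R \<noteq> UNIV"
    using assms(2) unfolding proper_retract_def retract_def by blast
  have \<phi>\<phi>: "\<phi> (\<phi> f) = \<phi> f" for f
    using idem by (metis comp_apply)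
  have \<phi>p: "\<phi> (p k) = p k" for k
  proof -
    have "p k \<in> range \<phi>"
      unfolding R assms(3) by (rule hull_inc) simp
    then show ?thesis using \<phi>\<phi> by auto
  qed
  obtain i where i: "\<phi> (Var i) \<noteq> Var i"
  proof -
    have "\<exists>i. \<phi> (Var i) \<noteq> Var i"
    proof (rule ccontr)
      assume "\<not> ?thesis"
      then have fixed: "\<phi> (Var i) = Var i" for i by blast
      have "\<phi> f = poly_subst Var f" for f
        by (rule alg_hom_eqI[OF hom alg_hom_poly_subst]) (simp add: fixed)
      then have "\<phi> f = f" for f by simp
      then have "range \<phi> = UNIV" by (rule surjI)
      with R \<open>R \<noteq> UNIV\<close> show False by simp
    qed
    then show ?thesis using that by blast
  qed
  have "\<exists>f. \<phi> (Var j) = poly_subst p f" for j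
  proof -
    have "\<phi> (Var j) \<in> subalgebra hull (range p)"
      using R assms(3) by blast
    then show ?thesis
      using subalgebra_hull_subset_range_poly_subst by blast
  qed
  then obtain Q where Q: "\<And>j. \<phi> (Var j) = poly_subst p (Q j)"
    by metis
  have \<phi>_eq: "\<phi> f = poly_subst p (poly_subst Q f)" for f
    by (rule alg_hom_eqI[OF hom]) (simp_all add: Q alg_hom_comp alg_hom_poly_subst)
  have "poly_subst Q (p k) = Var k" for k
    by (rule injD[OF inj]) (simp add: \<phi>p flip: \<phi>_eq)
  moreover have "poly_subst Q (Var i - \<phi> (Var i)) = 0"
  proof (rule injD[OF inj])
    have "poly_subst p (poly_subst Q (Var i - \<phi> (Var i))) = 0"
      by (simp add: alg_hom_diff[OF hom] \<phi>\<phi> flip: \<phi>_eq)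
    then show "poly_subst p (poly_subst Q (Var i - \<phi> (Var i))) = poly_subst p 0"
      by (simp add: alg_hom_0[OF alg_hom_poly_subst])
  qed
  ultimately have "Var i - \<phi> (Var i) = 0"
    by (rule poly_subst_injective_if_left_inverse)
  with i show False by simp
qed

end
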